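(* Let $\Gamma>0$, $\beta>0$, $p>0$ and $\alpha>0$ be real parameters. Consider the continuous-time Markov chain on the lattice $\frac1\Gamma\mathbb{Z}_+\times\mathbb{Z}_+$ governed by the generator $$(\mathbf{L}_1 g)(x,y)=xy\,[g(x-\tfrac1\Gamma,y+1)-g(x,y)]+\alpha x\,[g(x-\tfrac1\Gamma,y+1)-g(x,y)]+y\,[g(x+\tfrac1\Gamma,y-1)-g(x,y)]+p\,[g(x+\tfrac1\Gamma,y)-g(x,y)]+\beta^{-1}y\,[g(x,y-1)-g(x,y)].$$ If $\Gamma\ge\beta$, then this Markov chain is positive recurrent.
   Context: $\mathbb{Z}_+=\{0,1,2,\dots\}$, and $g$ ranges over functions with compact support on $\frac1\Gamma\mathbb{Z}_+\times\mathbb{Z}_+$. Equivalently, from a state $(x,y)$ the chain makes the transitions $(x,y)\to(x-\frac1\Gamma,y+1)$ at rate $xy+\alpha x$; $(x,y)\to(x+\frac1\Gamma,y-1)$ at rate $y$; $(x,y)\to(x+\frac1\Gamma,y)$ at rate $p$; $(x,y)\to(x,y-1)$ at rate $\beta^{-1}y$. *)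

theory Defs
  imports "HOL-Probability.Probability"
begin

section \<open>Continuous-time Markov chains on a countable state space\<close>

text \<open>
  A generator acts on real functions of the state. Its Q-matrix is obtained by applying it to the
  indicators of single states (which have compact support): off the diagonal the entries are the
  jump rates, and minus the diagonal entry is the total exit rate.
\<close>

definition Q_matrix :: "(('s \<Rightarrow> real) \<Rightarrow> 's \<Rightarrow> real) \<Rightarrow> 's \<Rightarrow> 's \<Rightarrow> real" where
  "Q_matrix L i j = L (indicator {j}) i"

definition exit_rate :: "('s \<Rightarrow> 's \<Rightarrow> real) \<Rightarrow> 's \<Rightarrow> real" where
  "exit_rate Q i = - Q i i"

definition jump_matrix :: "('s \<Rightarrow> 's \<Rightarrow> real) \<Rightarrow> 's \<Rightarrow> 's \<Rightarrow> real" where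
  "jump_matrix Q i j =
     (if exit_rate Q i = 0 then (if j = i then 1 else 0)
      else if j = i then 0 else Q i j / exit_rate Q i)"

text \<open>
  \<open>P i\<close> is the law of the chain started at \<open>i\<close>, \<open>Y\<close> its jump chain and \<open>S n\<close> the time spent in
  \<open>Y n\<close>. The product formula says that \<open>Y\<close> is a discrete-time Markov chain with transition matrix
  \<open>jump_matrix Q\<close> and that, conditionally on \<open>Y\<close>, the holding times are independent and \<open>S n\<close> is
  exponential with parameter \<open>exit_rate Q (Y n)\<close> (almost surely infinite if that parameter is 0).
\<close>

definition is_markov_chain ::
  "'s set \<Rightarrow> ('s \<Rightarrow> 's \<Rightarrow> real) \<Rightarrow> ('s \<Rightarrow> 'w measure) \<Rightarrow> (nat \<Rightarrow> 'w \<Rightarrow> 's) \<Rightarrow> (nat \<Rightarrow> 'w \<Rightarrow> ennreal) \<Rightarrow> bool"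
  where
  "is_markov_chain E Q P Y S \<longleftrightarrow>
     countable E \<and>
     (\<forall>i\<in>E. prob_space (P i) \<and>
        (\<forall>n. Y n \<in> measurable (P i) (count_space E)) \<and>
        (\<forall>n. S n \<in> borel_measurable (P i)) \<and>
        (\<forall>n (s :: nat \<Rightarrow> 's) (t :: nat \<Rightarrow> real).
           (\<forall>k\<le>n. s k \<in> E \<and> t k \<ge> 0) \<longrightarrow>
           measure (P i) {\<omega> \<in> space (P i). \<forall>k\<le>n. Y k \<omega> = s k \<and> S k \<omega> > ennreal (t k)} =
             (if s 0 = i then 1 else 0)
             * (\<Prod>k<n. jump_matrix Q (s k) (s (Suc k)))
             * (\<Prod>k\<le>n. exp (- exit_rate Q (s k) * t k))))"

definition jump_time :: "(nat \<Rightarrow> 'w \<Rightarrow> ennreal) \<Rightarrow> nat \<Rightarrow> 'w \<Rightarrow> ennreal" where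
  "jump_time S n \<omega> = (\<Sum>k<n. S k \<omega>)"

text \<open>The (minimal) chain itself, with cemetery state \<open>None\<close> after a possible explosion.\<close>

definition chain_at ::
  "(nat \<Rightarrow> 'w \<Rightarrow> 's) \<Rightarrow> (nat \<Rightarrow> 'w \<Rightarrow> ennreal) \<Rightarrow> real \<Rightarrow> 'w \<Rightarrow> 's option" where
  "chain_at Y S t \<omega> =
     (if \<exists>n. jump_time S n \<omega> \<le> ennreal t \<and> ennreal t < jump_time S (Suc n) \<omega>
      then Some (Y (THE n. jump_time S n \<omega> \<le> ennreal t \<and> ennreal t < jump_time S (Suc n) \<omega>) \<omega>)
      else None)"

text \<open>First passage time to \<open>i\<close> after the first jump; infinite if \<open>i\<close> is not visited again.\<close>

definition return_time ::
  "(nat \<Rightarrow> 'w \<Rightarrow> 's) \<Rightarrow> (nat \<Rightarrow> 'w \<Rightarrow> ennreal) \<Rightarrow> 's \<Rightarrow> 'w \<Rightarrow> ennreal" where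
  "return_time Y S i \<omega> =
     Inf {ennreal t | t. t \<ge> 0 \<and> jump_time S 1 \<omega> \<le> ennreal t \<and> chain_at Y S t \<omega> = Some i}"

definition positive_recurrent_state ::
  "('s \<Rightarrow> 's \<Rightarrow> real) \<Rightarrow> ('s \<Rightarrow> 'w measure) \<Rightarrow> (nat \<Rightarrow> 'w \<Rightarrow> 's) \<Rightarrow> (nat \<Rightarrow> 'w \<Rightarrow> ennreal) \<Rightarrow> 's \<Rightarrow> bool"
  where
  "positive_recurrent_state Q P Y S i \<longleftrightarrow>
     exit_rate Q i = 0 \<or> (\<integral>\<^sup>+ \<omega>. return_time Y S i \<omega> \<partial>P i) < \<infinity>"

definition positive_recurrent ::
  "'s set \<Rightarrow> ('s \<Rightarrow> 's \<Rightarrow> real) \<Rightarrow> ('s \<Rightarrow> 'w measure) \<Rightarrow> (nat \<Rightarrow> 'w \<Rightarrow> 's) \<Rightarrow> (nat \<Rightarrow> 'w \<Rightarrow> ennreal) \<Rightarrow> bool"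
  where
  "positive_recurrent E Q P Y S \<longleftrightarrow> (\<forall>i\<in>E. positive_recurrent_state Q P Y S i)"


section \<open>The chain with generator \<open>L1\<close>\<close>

definition lattice_states :: "real \<Rightarrow> (real \<times> nat) set" where
  "lattice_states \<Gamma> = {(real m / \<Gamma>, y) | m y. True}"

text \<open>
  On the boundary, the terms whose target would leave the lattice (\<open>x = 0\<close> in the first two, the
  truncated \<open>y - 1\<close> for \<open>y = 0\<close> in the third and fifth) have coefficient 0.
\<close>

definition L1 :: "real \<Rightarrow> real \<Rightarrow> real \<Rightarrow> real \<Rightarrow> (real \<times> nat \<Rightarrow> real) \<Rightarrow> real \<times> nat \<Rightarrow> real" where
  "L1 \<Gamma> \<beta> p \<alpha> g = (\<lambda>(x, y).
       x * real y * (g (x - 1 / \<Gamma>, y + 1) - g (x, y))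
     + \<alpha> * x * (g (x - 1 / \<Gamma>, y + 1) - g (x, y))
     + real y * (g (x + 1 / \<Gamma>, y - 1) - g (x, y))
     + p * (g (x + 1 / \<Gamma>, y) - g (x, y))
     + inverse \<beta> * real y * (g (x, y - 1) - g (x, y)))"

lemma Q_matrix_L1_diag:
  assumes "\<Gamma> > 0"
  shows "Q_matrix (L1 \<Gamma> \<beta> p \<alpha>) (x, y) (x, y) =
    - ((x * real y + \<alpha> * x) + real y + p + inverse \<beta> * real y)"
  using assms by (cases y) (auto simp: Q_matrix_def L1_def indicator_def algebra_simps)

lemma Q_matrix_L1_jump:
  assumes "\<Gamma> > 0" and "(x', y') \<noteq> (x, y)"
  shows "Q_matrix (L1 \<Gamma> \<beta> p \<alpha>) (x, y) (x', y') =
    (if x' = x - 1 / \<Gamma> \<and> y' = y + 1 then x * real y + \<alpha> * x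
     else if x' = x + 1 / \<Gamma> \<and> Suc y' = y then real y
     else if x' = x + 1 / \<Gamma> \<and> y' = y then p
     else if x' = x \<and> Suc y' = y then inverse \<beta> * real y
     else 0)"
  using assms by (cases y) (auto simp: Q_matrix_def L1_def indicator_def algebra_simps)

end

theory Submission
  imports Defs
begin

text \<open>
  Measure the state in units, \<open>m = \<Gamma> x\<close>, and consider the linear function
  \<open>(1 + 1 / (2 * \<beta>)) * m + y\<close>. Conversions, at rate \<open>x (y + \<alpha>)\<close>, decrease it, deaths outweigh the
  reverse reaction by a factor of two, and immigration adds only a constant, so the generator maps
  it to a constant minus \<open>(x (y + \<alpha>) + y) / (2 * \<beta>)\<close>. The total exit rate grows no faster than
  \<open>x (y + \<alpha>) + y\<close>. Hence each jump decreases the function in the mean by a fixed amount, except on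
  a finite set of states (\<open>L1_lyapunov_drift\<close>).

  Any state \<open>i\<close> can be reached from everywhere by immigration, conversion and death
  (\<open>all_sites_reach\<close>). The discounted probability of hitting \<open>i\<close> is therefore positive on the finite
  set, and off \<open>i\<close> it is subharmonic, strictly so wherever it is positive. Subtracting a large multiple of it
  gives a nonnegative function whose mean decrease per jump is at least 1 at every state other
  than \<open>i\<close> (\<open>exists_lyapunov_off_state\<close>).

  By Foster's argument the jump chain started in \<open>i\<close> then returns to \<open>i\<close> after a number of jumps with
  finite mean (\<open>suminf_avoiding_finite\<close>). All exit rates are at least \<open>p\<close>, so every holding time before
  the return has a mean bounded by a constant, given that the return has not happened yet, and the
  return time has finite mean as well (\<open>expected_return_time_finite\<close>).
\<close>

section \<open>Return times of a jump chain\<close>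

lemma suminf_one_ennreal: "suminf (\<lambda>_. 1 :: ennreal) = \<infinity>"
proof -
  have "suminf (\<lambda>_. 1 :: ennreal) = (\<integral>\<^sup>+ (k::nat). 1 \<partial>count_space UNIV)"
    by (rule nn_integral_count_space_nat[symmetric])
  then show ?thesis
    by simp
qed

text \<open>Exponential holding times need not be integrated exactly: this layer-cake bound reduces the
  mean of a holding time to a geometric series of tail probabilities.\<close>

lemma ennreal_le_suminf_tails:
  fixes x :: ennreal
  shows "x \<le> (\<Sum>k. if ennreal (real k) < x then 1 else 0)"
proof (cases x)
  case (real r)
  let ?f = "\<lambda>k. if ennreal (real k) < x then 1 else (0::ennreal)"
  define N where "N = nat \<lceil>r\<rceil>"
  have "real k < r" if "k < N" for k
    using that real by (simp add: N_def) linarith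
  then have one: "?f k = 1" if "k < N" for k
    using that real by (simp add: ennreal_less_iff)
  have "r \<le> real N"
    using real by (simp add: N_def)
  then have "x \<le> (\<Sum>k<N. ?f k)"
    using real by (subst sum.cong[OF refl one]) (auto simp: ennreal_of_nat_eq_real_of_nat)
  also have "\<dots> \<le> (\<Sum>k. ?f k)"
    by (rule sum_le_suminf) auto
  finally show ?thesis .
next
  case top
  then show ?thesis
    by (simp add: suminf_one_ennreal)
qed

lemma jump_time_mono: "m \<le> n \<Longrightarrow> jump_time S m \<omega> \<le> jump_time S n \<omega>"
  unfolding jump_time_def by (rule sum_mono2) auto

text \<open>A visit after \<open>n\<close> jumps is a visit in continuous time, because the chain stays in \<open>Y n\<close>
  for a positive time; if the first \<open>n\<close> jumps take infinitely long the bound is trivial.\<close>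

lemma return_time_le_jump_time:
  assumes pos: "\<And>k. 0 < S k \<omega>" and n: "0 < n" and Y: "Y n \<omega> = i"
  shows "return_time Y S i \<omega> \<le> jump_time S n \<omega>"
proof (cases "jump_time S n \<omega>")
  case (real t)
  have Suc: "jump_time S (Suc n) \<omega> = jump_time S n \<omega> + S n \<omega>"
    by (simp add: jump_time_def)
  have "jump_time S n \<omega> < jump_time S (Suc n) \<omega>"
    using pos[of n] real ennreal_add_left_cancel_less[of "jump_time S n \<omega>" 0 "S n \<omega>"]
    unfolding Suc by simp
  then have n_at: "jump_time S n \<omega> \<le> ennreal t \<and> ennreal t < jump_time S (Suc n) \<omega>"
    using real by simp
  have "m = n" if m: "jump_time S m \<omega> \<le> ennreal t \<and> ennreal t < jump_time S (Suc m) \<omega>" for m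
  proof (rule ccontr)
    assume "m \<noteq> n"
    then consider "Suc m \<le> n" | "Suc n \<le> m" by linarith
    then show False
    proof cases
      case 1
      then show False
        using jump_time_mono[of "Suc m" n S \<omega>] m n_at by (meson leD order_trans)
    next
      case 2
      then show False
        using jump_time_mono[of "Suc n" m S \<omega>] m n_at by (meson leD order_trans)
    qed
  qed
  then have "(THE m. jump_time S m \<omega> \<le> ennreal t \<and> ennreal t < jump_time S (Suc m) \<omega>) = n"
    using n_at by blast
  then have "chain_at Y S t \<omega> = Some i"
    using n_at Y unfolding chain_at_def by auto
  moreover have "jump_time S 1 \<omega> \<le> ennreal t"
    using jump_time_mono[of 1 n S \<omega>] n real by simp
  ultimately have "return_time Y S i \<omega> \<le> ennreal t"
    unfolding return_time_def using real by (intro Inf_lower) auto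
  then show ?thesis
    using real by simp
qed simp

text \<open>The law of the pair of jump chain and holding times started from one fixed state \<open>i\<close>.
  Stochasticity of the jump matrix is stated as an integral over the countable state space, which
  covers infinitely many targets per state.\<close>

locale jump_holding_chain =
  fixes E :: "'s set" and Q :: "'s \<Rightarrow> 's \<Rightarrow> real" and P :: "'s \<Rightarrow> 'w measure"
    and Y :: "nat \<Rightarrow> 'w \<Rightarrow> 's" and S :: "nat \<Rightarrow> 'w \<Rightarrow> ennreal" and i :: 's
  assumes chain: "is_markov_chain E Q P Y S"
    and start: "i \<in> E"
    and jump_nonneg: "\<And>w z. w \<in> E \<Longrightarrow> z \<in> E \<Longrightarrow> 0 \<le> jump_matrix Q w z"
    and jump_sum: "\<And>w. w \<in> E \<Longrightarrow> (\<integral>\<^sup>+ z. ennreal (jump_matrix Q w z) \<partial>count_space E) = 1"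
begin

sublocale prob_space "P i"
  using chain start by (simp add: is_markov_chain_def)

lemma countable_states: "countable E"
  using chain by (simp add: is_markov_chain_def)

lemma Y_measurable [measurable]: "Y n \<in> measurable (P i) (count_space E)"
  using chain start by (simp add: is_markov_chain_def)

lemma S_measurable [measurable]: "S n \<in> borel_measurable (P i)"
  using chain start by (simp add: is_markov_chain_def)

lemma Y_in_states: "\<omega> \<in> space (P i) \<Longrightarrow> Y n \<omega> \<in> E"
  using measurable_space[OF Y_measurable[of n]] by simp

lemma Y_eq_sets [measurable]: "Measurable.pred (P i) (\<lambda>\<omega>. Y n \<omega> = s)"
proof -
  have "{\<omega> \<in> space (P i). Y n \<omega> = s} = Y n -` ({s} \<inter> E) \<inter> space (P i)"
    using Y_in_states by auto
  also have "\<dots> \<in> sets (P i)"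
    by (intro measurable_sets[OF Y_measurable]) auto
  finally show ?thesis by (simp add: pred_def)
qed

lemma Y_mem_sets [measurable]: "Measurable.pred (P i) (\<lambda>\<omega>. Y n \<omega> \<in> C)"
proof -
  have "{\<omega> \<in> space (P i). Y n \<omega> \<in> C} = Y n -` (C \<inter> E) \<inter> space (P i)"
    using Y_in_states by auto
  also have "\<dots> \<in> sets (P i)"
    by (intro measurable_sets[OF Y_measurable]) auto
  finally show ?thesis by (simp add: pred_def)
qed

definition path_weight :: "nat \<Rightarrow> (nat \<Rightarrow> 's) \<Rightarrow> real" where
  "path_weight n s = (if s 0 = i then 1 else 0) * (\<Prod>k<n. jump_matrix Q (s k) (s (Suc k)))"

text \<open>Events with strictly positive holding times are used throughout, because the law of the
  process is prescribed through the strict tails \<open>t k < S k\<close> only.\<close>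

definition path_event :: "nat \<Rightarrow> (nat \<Rightarrow> 's) \<Rightarrow> 'w set" where
  "path_event n s = {\<omega> \<in> space (P i). \<forall>k\<le>n. Y k \<omega> = s k \<and> 0 < S k \<omega>}"

lemma path_weight_nonneg: "(\<And>k. k \<le> n \<Longrightarrow> s k \<in> E) \<Longrightarrow> 0 \<le> path_weight n s"
  unfolding path_weight_def by (intro mult_nonneg_nonneg prod_nonneg) (auto intro: jump_nonneg)

lemma emeasure_path_event_tail:
  assumes "\<And>k. k \<le> n \<Longrightarrow> s k \<in> E" and u: "0 \<le> u"
  shows "emeasure (P i) (path_event n s \<inter> {\<omega> \<in> space (P i). ennreal u < S n \<omega>}) =
    ennreal (path_weight n s * exp (- exit_rate Q (s n) * u))"
proof -
  let ?t = "(\<lambda>k. 0 :: real)(n := u)"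
  have "path_event n s \<inter> {\<omega> \<in> space (P i). ennreal u < S n \<omega>} =
      {\<omega> \<in> space (P i). \<forall>k\<le>n. Y k \<omega> = s k \<and> ennreal (?t k) < S k \<omega>}"
    unfolding path_event_def using le_less_trans[of 0 "ennreal u"] by auto
  moreover have "measure (P i) \<dots> = (if s 0 = i then 1 else 0)
      * (\<Prod>k<n. jump_matrix Q (s k) (s (Suc k)))
      * (\<Prod>k\<le>n. exp (- exit_rate Q (s k) * ?t k))"
    using chain start assms unfolding is_markov_chain_def by auto
  moreover have "(\<Prod>k\<le>n. exp (- exit_rate Q (s k) * ?t k)) = exp (- exit_rate Q (s n) * u)"
    by (simp add: lessThan_Suc_atMost[symmetric])
  ultimately show ?thesis
    by (simp add: emeasure_eq_measure path_weight_def)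
qed

lemma emeasure_path_event:
  assumes "\<And>k. k \<le> n \<Longrightarrow> s k \<in> E"
  shows "emeasure (P i) (path_event n s) = ennreal (path_weight n s)"
proof -
  have "path_event n s \<inter> {\<omega> \<in> space (P i). ennreal 0 < S n \<omega>} = path_event n s"
    by (auto simp: path_event_def)
  then show ?thesis
    using emeasure_path_event_tail[of n s 0] assms by simp
qed

text \<open>The initial state is exempt from membership in \<open>C\<close>: with \<open>C = E - {i}\<close> and start in \<open>i\<close> the
  event says that the chain has not come back to \<open>i\<close> within \<open>n\<close> jumps and sits in \<open>w\<close> now.\<close>

definition history :: "'s set \<Rightarrow> nat \<Rightarrow> 's \<Rightarrow> 'w set" where
  "history C n w =
    {\<omega> \<in> space (P i). Y n \<omega> = w \<and> (\<forall>k\<le>n. 0 < S k \<omega> \<and> (0 < k \<longrightarrow> Y k \<omega> \<in> C))}"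

lemma history_sets [measurable]: "history C n w \<in> sets (P i)"
  unfolding history_def by measurable

text \<open>Conditional probabilities given the whole path pass to the coarser information recorded in
  \<open>history\<close>, which is a countable disjoint union of path events.\<close>

lemma emeasure_history_Int:
  assumes w: "w \<in> E" and X: "X \<in> sets (P i)"
    and path: "\<And>s. (\<And>k. k \<le> n \<Longrightarrow> s k \<in> E) \<Longrightarrow> s n = w \<Longrightarrow>
      emeasure (P i) (path_event n s \<inter> X) = emeasure (P i) (path_event n s) * \<kappa>"
  shows "emeasure (P i) (history C n w \<inter> X) = emeasure (P i) (history C n w) * \<kappa>"
proof -
  define I where "I = {s \<in> {..n} \<rightarrow>\<^sub>E E. s n = w \<and> (\<forall>k\<in>{1..n}. s k \<in> C)}"
  have I: "countable I"
    unfolding I_def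
    by (rule countable_subset[of _ "{..n} \<rightarrow>\<^sub>E E"]) (auto intro!: countable_PiE countable_states)
  have [measurable]: "path_event n s \<in> sets (P i)" for s
    unfolding path_event_def by measurable
  have disj: "disjoint_family_on (\<lambda>s. path_event n s \<inter> Z) I" for Z
    unfolding disjoint_family_on_def I_def path_event_def
    by (auto simp: PiE_iff intro!: extensionalityI[of _ "{..n}"])
  have split: "history C n w \<inter> Z = (\<Union>s\<in>I. path_event n s \<inter> Z)" for Z
  proof (intro equalityI subsetI)
    fix \<omega> assume \<omega>: "\<omega> \<in> history C n w \<inter> Z"
    let ?s = "restrict (\<lambda>k. Y k \<omega>) {..n}"
    have "?s \<in> I"
      using \<omega> Y_in_states by (auto simp: I_def history_def)
    moreover have "\<omega> \<in> path_event n ?s \<inter> Z"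
      using \<omega> by (auto simp: path_event_def history_def)
    ultimately show "\<omega> \<in> (\<Union>s\<in>I. path_event n s \<inter> Z)" by blast
  next
    fix \<omega> assume "\<omega> \<in> (\<Union>s\<in>I. path_event n s \<inter> Z)"
    then show "\<omega> \<in> history C n w \<inter> Z"
      by (auto simp: I_def path_event_def history_def)
  qed
  have "emeasure (P i) (history C n w \<inter> X) =
      (\<integral>\<^sup>+ s. emeasure (P i) (path_event n s \<inter> X) \<partial>count_space I)"
    unfolding split using X I disj by (intro emeasure_UN_countable) auto
  also have "\<dots> = (\<integral>\<^sup>+ s. emeasure (P i) (path_event n s) * \<kappa> \<partial>count_space I)"
    by (intro nn_integral_cong path) (auto simp: I_def)
  also have "\<dots> = (\<integral>\<^sup>+ s. emeasure (P i) (path_event n s) \<partial>count_space I) * \<kappa>"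
    by (simp add: nn_integral_multc)
  also have "(\<integral>\<^sup>+ s. emeasure (P i) (path_event n s) \<partial>count_space I) =
      emeasure (P i) (\<Union>s\<in>I. path_event n s)"
    using I disj[of UNIV] by (intro emeasure_UN_countable[symmetric]) auto
  also have "(\<Union>s\<in>I. path_event n s) = history C n w"
    using split[of UNIV] by simp
  finally show ?thesis .
qed

lemma emeasure_history_tail:
  assumes w: "w \<in> E" and u: "0 \<le> u"
  shows "emeasure (P i) (history C n w \<inter> {\<omega> \<in> space (P i). ennreal u < S n \<omega>}) =
    emeasure (P i) (history C n w) * ennreal (exp (- exit_rate Q w * u))"
proof (rule emeasure_history_Int[OF w])
  fix s assume "\<And>k. k \<le> n \<Longrightarrow> s k \<in> E" "s n = w"
  then show "emeasure (P i) (path_event n s \<inter> {\<omega> \<in> space (P i). ennreal u < S n \<omega>}) =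
      emeasure (P i) (path_event n s) * ennreal (exp (- exit_rate Q w * u))"
    using u by (simp add: emeasure_path_event_tail emeasure_path_event path_weight_nonneg ennreal_mult)
qed measurable

lemma emeasure_history_step:
  assumes w: "w \<in> E" and z: "z \<in> E"
  shows "emeasure (P i) (history C n w \<inter> {\<omega> \<in> space (P i). Y (Suc n) \<omega> = z \<and> 0 < S (Suc n) \<omega>}) =
    emeasure (P i) (history C n w) * ennreal (jump_matrix Q w z)"
proof (rule emeasure_history_Int[OF w])
  fix s assume s: "\<And>k. k \<le> n \<Longrightarrow> s k \<in> E" "s n = w"
  let ?s = "s(Suc n := z)"
  have "path_event n s \<inter> {\<omega> \<in> space (P i). Y (Suc n) \<omega> = z \<and> 0 < S (Suc n) \<omega>} =
      path_event (Suc n) ?s"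
    by (auto simp: path_event_def le_Suc_eq)
  moreover have "path_weight (Suc n) ?s = path_weight n s * jump_matrix Q w z"
    using s(2) by (simp add: path_weight_def)
  moreover have "emeasure (P i) (path_event (Suc n) ?s) = ennreal (path_weight (Suc n) ?s)"
    using s z by (intro emeasure_path_event) (auto simp: le_Suc_eq)
  ultimately show "emeasure (P i) (path_event n s \<inter>
        {\<omega> \<in> space (P i). Y (Suc n) \<omega> = z \<and> 0 < S (Suc n) \<omega>}) =
      emeasure (P i) (path_event n s) * ennreal (jump_matrix Q w z)"
    using s w z by (simp add: emeasure_path_event path_weight_nonneg jump_nonneg ennreal_mult)
qed measurable

text \<open>Forward equation for the jump chain killed when it leaves \<open>C\<close>.\<close>

lemma emeasure_history_Suc:
  assumes z: "z \<in> E"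
  shows "emeasure (P i) (history C (Suc n) z) = (if z \<in> C then
    (\<integral>\<^sup>+ w. emeasure (P i) (history C n w) * ennreal (jump_matrix Q w z) \<partial>count_space E) else 0)"
proof (cases "z \<in> C")
  case True
  let ?X = "{\<omega> \<in> space (P i). Y (Suc n) \<omega> = z \<and> 0 < S (Suc n) \<omega>}"
  have "history C (Suc n) z = (\<Union>w\<in>E. history C n w \<inter> ?X)"
    using True Y_in_states by (auto simp: history_def le_Suc_eq)
  moreover have "emeasure (P i) \<dots> = (\<integral>\<^sup>+ w. emeasure (P i) (history C n w \<inter> ?X) \<partial>count_space E)"
    by (intro emeasure_UN_countable countable_states)
       (auto simp: disjoint_family_on_def history_def)
  ultimately show ?thesis
    using True z by (simp add: emeasure_history_step cong: nn_integral_cong_simp)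
next
  case False
  then have "history C (Suc n) z = {}"
    by (auto simp: history_def)
  then show ?thesis
    using False by simp
qed

definition surviving :: "'s set \<Rightarrow> nat \<Rightarrow> 'w set" where
  "surviving C n = {\<omega> \<in> space (P i). \<forall>k\<le>n. 0 < S k \<omega> \<and> (0 < k \<longrightarrow> Y k \<omega> \<in> C)}"

lemma surviving_sets [measurable]: "surviving C n \<in> sets (P i)"
  unfolding surviving_def by measurable

lemma emeasure_surviving_Int:
  assumes [measurable]: "X \<in> sets (P i)"
  shows "emeasure (P i) (surviving C n \<inter> X) =
    (\<integral>\<^sup>+ w. emeasure (P i) (history C n w \<inter> X) \<partial>count_space E)"
proof -
  have "surviving C n \<inter> X = (\<Union>w\<in>E. history C n w \<inter> X)"
    using Y_in_states by (auto simp: history_def surviving_def)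
  moreover have "emeasure (P i) \<dots> = (\<integral>\<^sup>+ w. emeasure (P i) (history C n w \<inter> X) \<partial>count_space E)"
    by (intro emeasure_UN_countable countable_states)
       (auto simp: disjoint_family_on_def history_def)
  ultimately show ?thesis by simp
qed

lemma emeasure_surviving:
  "emeasure (P i) (surviving C n) = (\<integral>\<^sup>+ w. emeasure (P i) (history C n w) \<partial>count_space E)"
proof -
  have "surviving C n \<inter> space (P i) = surviving C n" "history C n w \<inter> space (P i) = history C n w" for w
    by (auto simp: surviving_def history_def)
  then show ?thesis
    using emeasure_surviving_Int[of "space (P i)" C n] by simp
qed

lemma emeasure_history_0:
  assumes "w \<in> E"
  shows "emeasure (P i) (history C 0 w) = (if w = i then 1 else 0)"
proof -
  have "history C 0 w = path_event 0 (\<lambda>_. w)"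
    by (auto simp: history_def path_event_def)
  then show ?thesis
    using emeasure_path_event[of 0 "\<lambda>_. w"] assms by (simp add: path_weight_def)
qed

lemma nn_integral_history_0:
  "(\<integral>\<^sup>+ w. emeasure (P i) (history C 0 w) * f w \<partial>count_space E) = f i"
proof -
  have "(\<integral>\<^sup>+ w. emeasure (P i) (history C 0 w) * f w \<partial>count_space E) =
      (\<Sum>w\<in>{i}. emeasure (P i) (history C 0 w) * f w)"
    using start by (intro nn_integral_count_space') (auto simp: emeasure_history_0)
  then show ?thesis
    using start by (simp add: emeasure_history_0)
qed

lemma nn_integral_history_Suc:
  assumes "\<And>z. z \<in> E \<Longrightarrow> z \<notin> C \<Longrightarrow> f z = 0"
  shows "(\<integral>\<^sup>+ z. emeasure (P i) (history C (Suc n) z) * f z \<partial>count_space E) =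
    (\<integral>\<^sup>+ w. emeasure (P i) (history C n w) *
      (\<integral>\<^sup>+ z. ennreal (jump_matrix Q w z) * f z \<partial>count_space E) \<partial>count_space E)"
proof -
  have "(\<integral>\<^sup>+ z. emeasure (P i) (history C (Suc n) z) * f z \<partial>count_space E) =
      (\<integral>\<^sup>+ z. (\<integral>\<^sup>+ w. emeasure (P i) (history C n w) * (ennreal (jump_matrix Q w z) * f z)
        \<partial>count_space E) \<partial>count_space E)"
    using assms
    by (intro nn_integral_cong) (auto simp: emeasure_history_Suc nn_integral_multc[symmetric] mult.assoc)
  also have "\<dots> = (\<integral>\<^sup>+ w. (\<integral>\<^sup>+ z. emeasure (P i) (history C n w) * (ennreal (jump_matrix Q w z) * f z)
        \<partial>count_space E) \<partial>count_space E)"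
    by (intro nn_integral_count_space_nn_integral countable_states) auto
  also have "\<dots> = (\<integral>\<^sup>+ w. emeasure (P i) (history C n w) *
      (\<integral>\<^sup>+ z. ennreal (jump_matrix Q w z) * f z \<partial>count_space E) \<partial>count_space E)"
    by (simp add: nn_integral_cmult)
  finally show ?thesis .
qed

text \<open>The product formula only speaks about positive holding times. That these have full
  probability follows because the path weights already add up to 1.\<close>

lemma AE_holding_times_pos: "AE \<omega> in P i. \<forall>k. 0 < S k \<omega>"
proof -
  have one: "emeasure (P i) (surviving E n) = 1" for n
  proof (induction n)
    case 0
    show ?case
      using nn_integral_history_0[of E "\<lambda>_. 1"] by (simp add: emeasure_surviving)
  next
    case (Suc n)
    have "emeasure (P i) (surviving E (Suc n)) =
        (\<integral>\<^sup>+ w. emeasure (P i) (history E n w) *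
          (\<integral>\<^sup>+ z. ennreal (jump_matrix Q w z) \<partial>count_space E) \<partial>count_space E)"
      using nn_integral_history_Suc[of E "\<lambda>_. 1" n] by (simp add: emeasure_surviving)
    also have "\<dots> = (\<integral>\<^sup>+ w. emeasure (P i) (history E n w) \<partial>count_space E)"
      by (intro nn_integral_cong) (simp add: jump_sum)
    also have "\<dots> = 1"
      using Suc.IH by (simp add: emeasure_surviving)
    finally show ?case .
  qed
  have "AE \<omega> in P i. 0 < S k \<omega>" for k
  proof -
    have "AE \<omega> in P i. \<omega> \<in> surviving E k"
      using one[of k] by (intro AE_prob_1) (simp add: emeasure_eq_measure)
    then show ?thesis
      by eventually_elim (auto simp: surviving_def)
  qed
  then show ?thesis
    by (simp add: AE_all_countable)
qed

text \<open>Survival up to jump \<open>n\<close> is decided by the path and the positivity of the holding times, so given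
  it the \<open>n\<close>-th holding time still has a tail of at most \<open>exp (- c t)\<close>.\<close>

lemma expected_holding_time_le:
  assumes "\<And>w. w \<in> E \<Longrightarrow> c \<le> exit_rate Q w"
  shows "(\<integral>\<^sup>+ \<omega>. S n \<omega> * indicator (surviving C n) \<omega> \<partial>P i) \<le>
    (\<Sum>k. ennreal (exp (- c) ^ k)) * emeasure (P i) (surviving C n)"
proof -
  let ?X = "\<lambda>k. {\<omega> \<in> space (P i). ennreal (real k) < S n \<omega>}"
  have tail: "emeasure (P i) (surviving C n \<inter> ?X k) \<le>
      ennreal (exp (- c) ^ k) * emeasure (P i) (surviving C n)" for k
  proof -
    have "emeasure (P i) (surviving C n \<inter> ?X k) =
        (\<integral>\<^sup>+ w. emeasure (P i) (history C n w) * ennreal (exp (- exit_rate Q w * real k)) \<partial>count_space E)"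
      by (subst emeasure_surviving_Int) (auto intro!: nn_integral_cong simp: emeasure_history_tail)
    also have "\<dots> \<le> (\<integral>\<^sup>+ w. emeasure (P i) (history C n w) * ennreal (exp (- c) ^ k) \<partial>count_space E)"
      using assms
      by (intro nn_integral_mono mult_left_mono ennreal_leI)
         (simp_all add: exp_of_nat_mult[symmetric] mult.commute[of _ "real k"] mult_left_mono)
    also have "\<dots> = ennreal (exp (- c) ^ k) * emeasure (P i) (surviving C n)"
      by (simp add: emeasure_surviving nn_integral_multc mult.commute[of "ennreal _"])
    finally show ?thesis .
  qed
  have "(\<integral>\<^sup>+ \<omega>. S n \<omega> * indicator (surviving C n) \<omega> \<partial>P i) \<le>
      (\<integral>\<^sup>+ \<omega>. (\<Sum>k. indicator (surviving C n \<inter> ?X k) \<omega>) \<partial>P i)"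
  proof (intro nn_integral_mono)
    fix \<omega> assume "\<omega> \<in> space (P i)"
    then have "(\<Sum>k. indicator (surviving C n \<inter> ?X k) \<omega>) =
        (\<Sum>k. if ennreal (real k) < S n \<omega> then 1 else 0 :: ennreal) * indicator (surviving C n) \<omega>"
      by (auto simp: indicator_def intro!: suminf_cong)
    then show "S n \<omega> * indicator (surviving C n) \<omega> \<le> (\<Sum>k. indicator (surviving C n \<inter> ?X k) \<omega>)"
      using ennreal_le_suminf_tails[of "S n \<omega>"] by (simp add: mult_right_mono)
  qed
  also have "\<dots> = (\<Sum>k. emeasure (P i) (surviving C n \<inter> ?X k))"
    by (subst nn_integral_suminf) auto
  also have "\<dots> \<le> (\<Sum>k. ennreal (exp (- c) ^ k) * emeasure (P i) (surviving C n))"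
    by (intro suminf_le tail) auto
  also have "\<dots> = (\<Sum>k. ennreal (exp (- c) ^ k)) * emeasure (P i) (surviving C n)"
    by simp
  finally show ?thesis .
qed

text \<open>Foster's criterion for the jump chain. The expectation of \<open>V\<close> at time \<open>n\<close> on the event of no
  return drops, from the first jump on, in each step by at least the probability of that event; as it cannot become
  negative, these probabilities have a finite sum, which is the mean number of jumps to return.\<close>

lemma suminf_avoiding_finite:
  fixes V :: "'s \<Rightarrow> ennreal"
  assumes drift: "\<And>w. w \<in> E \<Longrightarrow> w \<noteq> i \<Longrightarrow>
      (\<integral>\<^sup>+ z. ennreal (jump_matrix Q w z) * V z \<partial>count_space E) + 1 \<le> V w"
    and at_i: "(\<integral>\<^sup>+ z. ennreal (jump_matrix Q i z) * V z \<partial>count_space E) < \<infinity>"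
  shows "(\<Sum>n. emeasure (P i) (surviving (E - {i}) n)) < \<infinity>"
proof -
  define C where "C = E - {i}"
  define \<mu> where "\<mu> n w = emeasure (P i) (history C n w)" for n w
  (* Mass that arrives at i is killed there. *)
  define f where "f z = (if z = i then 0 else V z)" for z
  define a where "a n = (\<integral>\<^sup>+ w. \<mu> n w * f w \<partial>count_space E)" for n
  define A where "A = (\<integral>\<^sup>+ z. ennreal (jump_matrix Q i z) * V z \<partial>count_space E)"
  have Pf: "(\<integral>\<^sup>+ z. ennreal (jump_matrix Q w z) * f z \<partial>count_space E) \<le>
      (\<integral>\<^sup>+ z. ennreal (jump_matrix Q w z) * V z \<partial>count_space E)" for w
    by (intro nn_integral_mono mult_left_mono) (auto simp: f_def)
  have a_Suc: "a (Suc n) =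
      (\<integral>\<^sup>+ w. \<mu> n w * (\<integral>\<^sup>+ z. ennreal (jump_matrix Q w z) * f z \<partial>count_space E) \<partial>count_space E)" for n
    unfolding a_def \<mu>_def by (rule nn_integral_history_Suc) (auto simp: f_def C_def)
  have a1: "a 1 \<le> A"
    using a_Suc[of 0] Pf[of i] nn_integral_history_0[of C
      "\<lambda>w. \<integral>\<^sup>+ z. ennreal (jump_matrix Q w z) * f z \<partial>count_space E"]
    by (simp add: \<mu>_def A_def)
  have step: "a (Suc (Suc n)) + emeasure (P i) (surviving C (Suc n)) \<le> a (Suc n)" for n
  proof -
    have "a (Suc (Suc n)) + emeasure (P i) (surviving C (Suc n)) =
        (\<integral>\<^sup>+ w. \<mu> (Suc n) w *
          ((\<integral>\<^sup>+ z. ennreal (jump_matrix Q w z) * f z \<partial>count_space E) + 1) \<partial>count_space E)"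
      by (subst a_Suc) (simp add: emeasure_surviving \<mu>_def[symmetric] nn_integral_add[symmetric] distrib_left)
    also have "\<dots> \<le> a (Suc n)"
      unfolding a_def
    proof (intro nn_integral_mono)
      fix w assume "w \<in> space (count_space E)"
      then have w: "w \<in> E" by simp
      show "\<mu> (Suc n) w * ((\<integral>\<^sup>+ z. ennreal (jump_matrix Q w z) * f z \<partial>count_space E) + 1) \<le> \<mu> (Suc n) w * f w"
      proof (cases "w = i")
        case True
        then have "\<mu> (Suc n) w = 0"
          using start by (simp add: \<mu>_def emeasure_history_Suc C_def)
        then show ?thesis by simp
      next
        case False
        then have "(\<integral>\<^sup>+ z. ennreal (jump_matrix Q w z) * f z \<partial>count_space E) + 1 \<le> f w"
          using order_trans[OF add_right_mono[OF Pf[of w], of 1] drift[OF w False]]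
          by (simp add: f_def[of w])
        then show ?thesis by (rule mult_left_mono) simp
      qed
    qed
    finally show ?thesis .
  qed
  have partial: "a (Suc n) + (\<Sum>k<n. emeasure (P i) (surviving C (Suc k))) \<le> A" for n
  proof (induction n)
    case 0
    then show ?case using a1 by simp
  next
    case (Suc n)
    have "a (Suc (Suc n)) + (\<Sum>k<Suc n. emeasure (P i) (surviving C (Suc k))) =
        (a (Suc (Suc n)) + emeasure (P i) (surviving C (Suc n))) + (\<Sum>k<n. emeasure (P i) (surviving C (Suc k)))"
      by (simp add: add_ac)
    also have "\<dots> \<le> a (Suc n) + (\<Sum>k<n. emeasure (P i) (surviving C (Suc k)))"
      by (rule add_right_mono[OF step])
    also have "\<dots> \<le> A" by (rule Suc.IH)
    finally show ?case .
  qed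
  have "(\<Sum>k<n. emeasure (P i) (surviving C (Suc k))) \<le> A" for n
    by (rule order_trans[OF _ partial[of n]]) simp
  then have "(\<Sum>k. emeasure (P i) (surviving C (Suc k))) \<le> A"
    by (intro suminf_le_const) auto
  moreover have "(\<Sum>n. emeasure (P i) (surviving C n)) =
      (\<Sum>k. emeasure (P i) (surviving C (Suc k))) + emeasure (P i) (surviving C 0)"
    using suminf_offset[of "\<lambda>n. emeasure (P i) (surviving C n)" 1] by (simp add: add.commute)
  moreover have "emeasure (P i) (surviving C 0) < \<infinity>"
    by (simp add: less_top[symmetric])
  ultimately show ?thesis
    using at_i le_less_trans[of _ A \<infinity>] by (simp add: C_def[symmetric] A_def[symmetric])
qed

text \<open>Each jump costs a bounded mean time, since all exit rates are at least \<open>c\<close>. The summand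
  \<open>S n + 1\<close> instead of \<open>S n\<close> makes the bounding series diverge on paths that never return,
  so that recurrence comes out of the same estimate and explosion needs no separate argument.\<close>

lemma expected_return_time_finite:
  fixes V :: "'s \<Rightarrow> ennreal"
  assumes rate: "\<And>w. w \<in> E \<Longrightarrow> c \<le> exit_rate Q w" and c: "0 < c"
    and drift: "\<And>w. w \<in> E \<Longrightarrow> w \<noteq> i \<Longrightarrow>
      (\<integral>\<^sup>+ z. ennreal (jump_matrix Q w z) * V z \<partial>count_space E) + 1 \<le> V w"
    and at_i: "(\<integral>\<^sup>+ z. ennreal (jump_matrix Q i z) * V z \<partial>count_space E) < \<infinity>"
  shows "(\<integral>\<^sup>+ \<omega>. return_time Y S i \<omega> \<partial>P i) < \<infinity>"
proof -
  define A where "A n = surviving (E - {i}) n" for n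
  have [measurable]: "A n \<in> sets (P i)" for n
    by (simp add: A_def)
  define K where "K = (\<Sum>k. ennreal (exp (- c) ^ k))"
  have K: "K < \<infinity>"
    unfolding K_def using c
    by (simp add: less_top[symmetric] ennreal_suminf_neq_top summable_geometric del: ennreal_power)
  have "AE \<omega> in P i. return_time Y S i \<omega> \<le> (\<Sum>n. (S n \<omega> + 1) * indicator (A n) \<omega>)"
    using AE_holding_times_pos AE_space
  proof eventually_elim
    case (elim \<omega>)
    show ?case
    proof (cases "\<exists>n>0. Y n \<omega> = i")
      case True
      define n where "n = (LEAST n. 0 < n \<and> Y n \<omega> = i)"
      have n: "0 < n \<and> Y n \<omega> = i"
        unfolding n_def using True by (rule LeastI_ex)
      have before: "\<omega> \<in> A k" if "k < n" for k
      proof -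
        have "Y j \<omega> \<noteq> i" if "0 < j" "j \<le> k" for j
          using not_less_Least[of j "\<lambda>n. 0 < n \<and> Y n \<omega> = i"] that \<open>k < n\<close> n_def by auto
        then show ?thesis
          using elim Y_in_states by (auto simp: A_def surviving_def)
      qed
      have "return_time Y S i \<omega> \<le> (\<Sum>k<n. S k \<omega>)"
        using return_time_le_jump_time[of S \<omega> n Y i] elim n by (simp add: jump_time_def)
      also have "\<dots> \<le> (\<Sum>k<n. (S k \<omega> + 1) * indicator (A k) \<omega>)"
        by (intro sum_mono) (simp add: before)
      also have "\<dots> \<le> (\<Sum>k. (S k \<omega> + 1) * indicator (A k) \<omega>)"
        by (rule sum_le_suminf) auto
      finally show ?thesis .
    next
      case False
      (* On a path that never returns every summand is at least 1. *)
      then have "\<omega> \<in> A k" for k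
        using elim Y_in_states[of \<omega>] unfolding A_def surviving_def by blast
      then have "(\<Sum>k. (1::ennreal)) \<le> (\<Sum>k. (S k \<omega> + 1) * indicator (A k) \<omega>)"
        by (intro suminf_le) auto
      then show ?thesis
        by (simp add: suminf_one_ennreal top_unique)
    qed
  qed
  then have "(\<integral>\<^sup>+ \<omega>. return_time Y S i \<omega> \<partial>P i) \<le>
      (\<integral>\<^sup>+ \<omega>. (\<Sum>n. (S n \<omega> + 1) * indicator (A n) \<omega>) \<partial>P i)"
    by (rule nn_integral_mono_AE)
  also have "\<dots> = (\<Sum>n. (\<integral>\<^sup>+ \<omega>. S n \<omega> * indicator (A n) \<omega> \<partial>P i) + emeasure (P i) (A n))"
    by (subst nn_integral_suminf) (auto simp: distrib_right nn_integral_add)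
  also have "\<dots> \<le> (\<Sum>n. (K + 1) * emeasure (P i) (A n))"
  proof (intro suminf_le)
    fix n
    have "(\<integral>\<^sup>+ \<omega>. S n \<omega> * indicator (A n) \<omega> \<partial>P i) \<le> K * emeasure (P i) (A n)"
      unfolding A_def K_def by (rule expected_holding_time_le) (rule rate)
    then show "(\<integral>\<^sup>+ \<omega>. S n \<omega> * indicator (A n) \<omega> \<partial>P i) + emeasure (P i) (A n) \<le>
        (K + 1) * emeasure (P i) (A n)"
      by (simp add: distrib_right add_right_mono)
  qed simp_all
  also have "\<dots> = (K + 1) * (\<Sum>n. emeasure (P i) (A n))"
    by simp
  also have "\<dots> < \<infinity>"
  proof -
    have "(\<Sum>n. emeasure (P i) (A n)) < \<infinity>"
      unfolding A_def by (rule suminf_avoiding_finite[OF _ at_i]) (rule drift)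
    then show ?thesis
      using K by (simp add: ennreal_mult_less_top)
  qed
  finally show ?thesis .
qed

end

section \<open>Communication between sites\<close>

text \<open>The rules are steps of the chain read backwards. To get from \<open>(m, y)\<close> to \<open>(m0, y0)\<close>, let
  \<open>m0 + y0\<close> immigrants arrive, convert \<open>m + y0\<close> units, so that \<open>m0\<close> are left unconverted and at
  least \<open>y0\<close> are converted, and let the excess of converted units die. Immigration in the first
  stage supplies the units that the conversions use up.\<close>

lemma all_sites_reach:
  assumes start: "R m0 y0"
    and birth: "\<And>m y. R (Suc m) y \<Longrightarrow> R m y"
    and death: "\<And>m y. R m y \<Longrightarrow> R m (Suc y)"
    and conversion: "\<And>m y. R m (Suc y) \<Longrightarrow> R (Suc m) y"
  shows "R m y"
proof -
  have deaths: "R m0 (y0 + k)" for k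
    by (induction k) (auto intro: start death)
  have conversions: "R (m0 + j) y" if "y0 \<le> y + j" for j y
    using that
  proof (induction j arbitrary: y)
    case 0
    then show ?case using deaths[of "y - y0"] by simp
  next
    case (Suc j)
    then show ?case using conversion[of "m0 + j" y] by simp
  qed
  have births: "R m y" if "R (m + k) y" for k
    using that by (induction k) (auto intro: birth)
  show ?thesis
    using births[of "m0 + y0"] conversions[of y "y0 + m"] by (simp add: add_ac)
qed

section \<open>The jump chain of the generator\<close>

locale reaction_chain =
  fixes \<Gamma> \<beta> p \<alpha> :: real
  assumes \<Gamma>: "0 < \<Gamma>" and \<beta>: "0 < \<beta>" and p: "0 < p" and \<alpha>: "0 < \<alpha>"
begin

abbreviation E where "E \<equiv> lattice_states \<Gamma>"
abbreviation L where "L \<equiv> L1 \<Gamma> \<beta> p \<alpha>"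
abbreviation Q where "Q \<equiv> Q_matrix L"
abbreviation q where "q \<equiv> exit_rate Q"

definition site :: "nat \<Rightarrow> nat \<Rightarrow> real \<times> nat" where
  "site m y = (real m / \<Gamma>, y)"

lemma site_in_states [simp]: "site m y \<in> E"
  by (auto simp: site_def lattice_states_def)

lemma statesE:
  assumes "w \<in> E" obtains m y where "w = site m y"
  using assms by (auto simp: site_def lattice_states_def)

lemma exit_rate_site:
  "q (site m y) = real m / \<Gamma> * (real y + \<alpha>) + real y + p + inverse \<beta> * real y"
  unfolding exit_rate_def site_def Q_matrix_L1_diag[OF \<Gamma>]
  by (simp add: algebra_simps add_divide_distrib)

lemma exit_rate_ge: "w \<in> E \<Longrightarrow> p \<le> q w"
  using \<Gamma> \<beta> \<alpha> by (auto elim!: statesE simp: exit_rate_site)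

lemma exit_rate_pos: "w \<in> E \<Longrightarrow> 0 < q w"
  using exit_rate_ge p by fastforce

text \<open>Truncated subtraction of naturals is harmless here: it only occurs at rate 0.\<close>

lemma L1_site:
  "L f (site m y) =
     real m / \<Gamma> * (real y + \<alpha>) * (f (site (m - 1) (y + 1)) - f (site m y))
   + real y * (f (site (m + 1) (y - 1)) - f (site m y))
   + p * (f (site (m + 1) y) - f (site m y))
   + inverse \<beta> * real y * (f (site m (y - 1)) - f (site m y))"
proof -
  have eq: "L f (x, y) =
     x * (real y + \<alpha>) * (f (x - 1 / \<Gamma>, y + 1) - f (x, y))
   + real y * (f (x + 1 / \<Gamma>, y - 1) - f (x, y))
   + p * (f (x + 1 / \<Gamma>, y) - f (x, y))
   + inverse \<beta> * real y * (f (x, y - 1) - f (x, y))" for x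
    by (simp add: L1_def algebra_simps)
  have up: "real m / \<Gamma> + 1 / \<Gamma> = real (m + 1) / \<Gamma>"
    by (simp add: add_divide_distrib)
  have down: "real m / \<Gamma> - 1 / \<Gamma> = real (m - 1) / \<Gamma>" if "m \<noteq> 0"
    using that by (simp add: of_nat_diff diff_divide_distrib)
  show ?thesis
    unfolding site_def eq up by (cases "m = 0") (simp_all add: down del: of_nat_diff of_nat_diff_if)
qed

definition average :: "(real \<times> nat \<Rightarrow> real) \<Rightarrow> real \<times> nat \<Rightarrow> real" where
  "average f w = f w + L f w / q w"

lemma average_site:
  "q (site m y) * average f (site m y) =
     real m / \<Gamma> * (real y + \<alpha>) * f (site (m - 1) (y + 1)) + real y * f (site (m + 1) (y - 1))
   + p * f (site (m + 1) y) + inverse \<beta> * real y * f (site m (y - 1))"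
proof -
  have "q (site m y) * average f (site m y) = q (site m y) * f (site m y) + L f (site m y)"
    using exit_rate_pos[of "site m y"] by (simp add: average_def distrib_left)
  then show ?thesis
    unfolding L1_site exit_rate_site by (simp add: algebra_simps)
qed

lemma average_mono:
  assumes "\<And>z. z \<in> E \<Longrightarrow> f z \<le> g z" and w: "w \<in> E"
  shows "average f w \<le> average g w"
proof -
  obtain m y where my: "w = site m y" using w by (rule statesE)
  have "q w * average f w \<le> q w * average g w"
    unfolding my average_site using \<Gamma> \<beta> p \<alpha> assms(1)
    by (intro add_mono mult_left_mono) auto
  then show ?thesis
    using exit_rate_pos[OF w] by simp
qed

lemma average_const: "w \<in> E \<Longrightarrow> average (\<lambda>_. c) w = c"
  by (auto simp: average_def L1_def split: prod.split)

lemma average_nonneg: "(\<And>z. z \<in> E \<Longrightarrow> 0 \<le> f z) \<Longrightarrow> w \<in> E \<Longrightarrow> 0 \<le> average f w"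
  using average_mono[of "\<lambda>_. 0" f w] by (simp add: average_const)

definition targets :: "real \<times> nat \<Rightarrow> (real \<times> nat) set" where
  "targets = (\<lambda>(x, y). {(x, y), (x - 1 / \<Gamma>, y + 1), (x + 1 / \<Gamma>, y - 1), (x + 1 / \<Gamma>, y), (x, y - 1)})"

text \<open>A row of the Q-matrix collects the values of \<open>L\<close> on indicators, and \<open>L f\<close> only looks at
  finitely many states; linearity therefore recovers \<open>L f\<close> from the row, even where some of the
  targets coincide or fall off the lattice.\<close>

lemma L1_sum:
  "finite T \<Longrightarrow> L (\<lambda>v. \<Sum>z\<in>T. f z * g z v) w = (\<Sum>z\<in>T. f z * L (g z) w)"
proof (induction T rule: finite_induct)
  case empty
  then show ?case by (simp add: L1_def split: prod.split)
next
  case (insert a T)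
  have "L (\<lambda>v. \<Sum>z\<in>insert a T. f z * g z v) w = f a * L (g a) w + L (\<lambda>v. \<Sum>z\<in>T. f z * g z v) w"
    using insert.hyps by (simp add: L1_def algebra_simps split: prod.split)
  then show ?case
    using insert by simp
qed

lemma sum_Q_matrix: "(\<Sum>z\<in>targets w. Q w z * f z) = L f w"
proof -
  have fin: "finite (targets w)"
    by (simp add: targets_def split: prod.split)
  have "(\<Sum>z\<in>targets w. Q w z * f z) = L (\<lambda>v. \<Sum>z\<in>targets w. f z * indicator {z} v) w"
    using L1_sum[OF fin, of f "\<lambda>z. indicator {z}" w] by (simp add: Q_matrix_def mult.commute)
  also have "\<dots> = L f w"
  proof -
    have "(\<Sum>z\<in>targets w. f z * indicator {z} v) = f v" if "v \<in> targets w" for v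
      using that fin by (simp add: indicator_def if_distrib sum.delta cong: if_cong)
    then show ?thesis
      by (auto simp: L1_def targets_def split: prod.split)
  qed
  finally show ?thesis .
qed

lemma Q_off_diagonal:
  assumes w: "w \<in> E" and z: "z \<noteq> w"
  shows "0 \<le> Q w z" and "Q w z \<noteq> 0 \<Longrightarrow> z \<in> targets w \<and> z \<in> E"
proof -
  obtain m y where my: "w = site m y" using w by (rule statesE)
  obtain x' y' where z': "z = (x', y')" by (cases z)
  have eq: "Q w z =
    (if x' = real m / \<Gamma> - 1 / \<Gamma> \<and> y' = y + 1 then real m / \<Gamma> * real y + \<alpha> * (real m / \<Gamma>)
     else if x' = real m / \<Gamma> + 1 / \<Gamma> \<and> Suc y' = y then real y
     else if x' = real m / \<Gamma> + 1 / \<Gamma> \<and> y' = y then p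
     else if x' = real m / \<Gamma> \<and> Suc y' = y then inverse \<beta> * real y
     else 0)"
    using z unfolding my z' site_def by (intro Q_matrix_L1_jump \<Gamma>) auto
  show "0 \<le> Q w z"
    unfolding eq using \<Gamma> \<beta> p \<alpha> by simp
  assume "Q w z \<noteq> 0"
  note nz = this[unfolded eq]
  have "z \<in> targets w"
    using nz unfolding my z' site_def targets_def by (auto split: if_splits)
  moreover have "z \<in> E"
  proof -
    have "\<exists>m'. x' = real m' / \<Gamma>"
    proof (cases "x' = real m / \<Gamma> - 1 / \<Gamma> \<and> y' = y + 1")
      case True
      then have "m \<noteq> 0" using nz by (cases m) auto
      then have "x' = real (m - 1) / \<Gamma>"
        using True by (simp add: of_nat_diff diff_divide_distrib)
      then show ?thesis ..
    next
      case False
      then have "x' = real (m + 1) / \<Gamma> \<or> x' = real m / \<Gamma>"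
        using nz by (auto simp: add_divide_distrib split: if_splits)
      then show ?thesis by blast
    qed
    then show ?thesis
      unfolding z' lattice_states_def by auto
  qed
  ultimately show "z \<in> targets w \<and> z \<in> E" ..
qed

lemma jump_matrix_off_diagonal:
  "w \<in> E \<Longrightarrow> jump_matrix Q w z = (if z = w then 0 else Q w z / q w)"
  using exit_rate_pos[of w] by (simp add: jump_matrix_def)

lemma jump_matrix_nonneg: "w \<in> E \<Longrightarrow> 0 \<le> jump_matrix Q w z"
  using exit_rate_pos[of w] Q_off_diagonal(1)[of w z] by (simp add: jump_matrix_off_diagonal)

text \<open>\<open>average\<close> is one step of the jump chain; thus the infinite sums over
  states become evaluations of the generator.\<close>

lemma nn_integral_jump_matrix:
  assumes w: "w \<in> E" and f: "\<And>z. z \<in> E \<Longrightarrow> 0 \<le> f z"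
  shows "(\<integral>\<^sup>+ z. ennreal (jump_matrix Q w z) * ennreal (f z) \<partial>count_space E) = ennreal (average f w)"
proof -
  let ?T = "targets w - {w}"
  have fin: "finite (targets w)" and mem: "w \<in> targets w"
    by (simp_all add: targets_def split: prod.split)
  have "(\<integral>\<^sup>+ z. ennreal (jump_matrix Q w z) * ennreal (f z) \<partial>count_space E) =
      (\<Sum>z\<in>?T \<inter> E. ennreal (jump_matrix Q w z) * ennreal (f z))"
  proof (rule nn_integral_count_space')
    fix z assume "z \<in> E" "z \<notin> ?T \<inter> E"
    then have "jump_matrix Q w z = 0"
      using Q_off_diagonal(2)[OF w, of z] by (auto simp: jump_matrix_off_diagonal[OF w])
    then show "ennreal (jump_matrix Q w z) * ennreal (f z) = 0"
      by simp
  qed (use fin in auto)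
  also have "\<dots> = (\<Sum>z\<in>?T \<inter> E. ennreal (jump_matrix Q w z * f z))"
    by (intro sum.cong refl ennreal_mult[symmetric] jump_matrix_nonneg w) (auto intro: f)
  also have "\<dots> = ennreal (\<Sum>z\<in>?T \<inter> E. jump_matrix Q w z * f z)"
    by (intro sum_ennreal mult_nonneg_nonneg jump_matrix_nonneg w) (auto intro: f)
  also have "(\<Sum>z\<in>?T \<inter> E. jump_matrix Q w z * f z) = (\<Sum>z\<in>?T. jump_matrix Q w z * f z)"
    using fin Q_off_diagonal(2)[OF w]
    by (intro sum.mono_neutral_left) (auto simp: jump_matrix_off_diagonal[OF w])
  also have "\<dots> = (\<Sum>z\<in>?T. Q w z * f z) / q w"
    by (simp add: jump_matrix_off_diagonal[OF w] sum_divide_distrib)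
  also have "(\<Sum>z\<in>?T. Q w z * f z) = L f w - Q w w * f w"
    using sum_Q_matrix[of w f] sum.remove[OF fin mem, of "\<lambda>z. Q w z * f z"] by simp
  also have "(L f w - Q w w * f w) / q w = average f w"
    using exit_rate_pos[OF w] by (simp add: average_def exit_rate_def field_simps)
  finally show ?thesis .
qed

lemma jump_matrix_sum: "w \<in> E \<Longrightarrow> (\<integral>\<^sup>+ z. ennreal (jump_matrix Q w z) \<partial>count_space E) = 1"
  using nn_integral_jump_matrix[of w "\<lambda>_. 1"] by (simp add: average_const)

section \<open>Discounted hitting probabilities of a state\<close>

text \<open>\<open>hit i n z\<close> is the expectation of \<open>2 ^ (- T)\<close> on \<open>T \<le> n\<close>, where \<open>T\<close> is the number of jumps
  needed to reach \<open>i\<close> from \<open>z\<close>.\<close>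

primrec hit :: "real \<times> nat \<Rightarrow> nat \<Rightarrow> real \<times> nat \<Rightarrow> real" where
  "hit i 0 z = (if z = i then 1 else 0)"
| "hit i (Suc n) z = (if z = i then 1 else average (hit i n) z / 2)"

lemma hit_bounds: "z \<in> E \<Longrightarrow> 0 \<le> hit i n z \<and> hit i n z \<le> 1"
proof (induction n arbitrary: z)
  case (Suc n)
  have "0 \<le> average (hit i n) z" "average (hit i n) z \<le> 1"
    using Suc average_nonneg[of "hit i n" z] average_mono[of "hit i n" "\<lambda>_. 1" z]
    by (simp_all add: average_const)
  then show ?case by simp
qed simp

lemma hit_Suc_ge: "z \<in> E \<Longrightarrow> hit i n z \<le> hit i (Suc n) z"
proof (induction n arbitrary: z)
  case 0
  then show ?case
    using average_nonneg[of "hit i 0" z] by simp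
next
  case (Suc n)
  then show ?case
    using average_mono[of "hit i n" "hit i (Suc n)" z] by simp
qed

lemma hit_mono: "z \<in> E \<Longrightarrow> m \<le> n \<Longrightarrow> hit i m z \<le> hit i n z"
  by (rule lift_Suc_mono_le[where f = "\<lambda>n. hit i n z"]) (rule hit_Suc_ge)

text \<open>The factor \<open>1 / 2\<close> per jump makes the discounted hitting probability subharmonic at every state
  other than \<open>i\<close>, and strictly so wherever it is positive. Monotonicity in \<open>n\<close> is what allows stopping the
  iteration at a finite stage.\<close>

lemma L1_hit_ge:
  assumes z: "z \<in> E" and "z \<noteq> i"
  shows "q z * hit i n z \<le> L (hit i n) z"
proof -
  have "2 * hit i n z \<le> average (hit i n) z"
    using hit_Suc_ge[OF z, of i n] assms(2) by simp
  then have "q z * (2 * hit i n z) \<le> q z * average (hit i n) z"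
    using exit_rate_pos[OF z] by simp
  then show ?thesis
    using exit_rate_pos[OF z] by (simp add: average_def distrib_left)
qed

lemma hit_pos_eventually:
  assumes i: "i \<in> E"
  shows "\<exists>n. 0 < hit i n (site m y)"
proof -
  obtain m0 y0 where i_eq: "i = site m0 y0" using i by (rule statesE)
  have step: "\<exists>n. 0 < hit i n (site m y)" if "0 < q (site m y) * average (hit i n) (site m y)" for m y n
  proof -
    have "0 < average (hit i n) (site m y)"
      using that exit_rate_pos[of "site m y"] by (simp add: zero_less_mult_iff)
    then have "0 < hit i (Suc n) (site m y)" by simp
    then show ?thesis ..
  qed
  have nonneg: "0 \<le> hit i n (site m y)" for n m y
    using hit_bounds by simp
  show ?thesis
  proof (rule all_sites_reach[where R = "\<lambda>m y. \<exists>n. 0 < hit i n (site m y)"])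
    have "0 < hit i 0 (site m0 y0)"
      by (simp add: i_eq)
    then show "\<exists>n. 0 < hit i n (site m0 y0)" ..
  next
    fix m y assume "\<exists>n. 0 < hit i n (site (Suc m) y)"
    then obtain n where "0 < hit i n (site (Suc m) y)" ..
    then have "0 < q (site m y) * average (hit i n) (site m y)"
      unfolding average_site using \<Gamma> \<beta> \<alpha> p nonneg
      by (intro add_nonneg_pos add_pos_nonneg) auto
    then show "\<exists>n. 0 < hit i n (site m y)" by (rule step)
  next
    fix m y assume "\<exists>n. 0 < hit i n (site m y)"
    then obtain n where "0 < hit i n (site m y)" ..
    then have "0 < q (site m (Suc y)) * average (hit i n) (site m (Suc y))"
      unfolding average_site using \<Gamma> \<beta> \<alpha> p nonneg
      by (intro add_nonneg_pos) auto
    then show "\<exists>n. 0 < hit i n (site m (Suc y))" by (rule step)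
  next
    fix m y assume "\<exists>n. 0 < hit i n (site m (Suc y))"
    then obtain n where "0 < hit i n (site m (Suc y))" ..
    then have "0 < q (site (Suc m) y) * average (hit i n) (site (Suc m) y)"
      unfolding average_site using \<Gamma> \<beta> \<alpha> p nonneg
      by (intro add_pos_nonneg) (auto intro!: mult_pos_pos add_nonneg_pos divide_pos_pos)
    then show "\<exists>n. 0 < hit i n (site (Suc m) y)" by (rule step)
  qed
qed

lemma hit_bounded_below:
  assumes i: "i \<in> E" and "finite F" and "F \<subseteq> E"
  shows "\<exists>n \<delta>. 0 < \<delta> \<and> (\<forall>z\<in>F. \<delta> \<le> hit i n z)"
  using assms(2,3)
proof (induction F rule: finite_induct)
  case empty
  then show ?case by (auto intro: exI[of _ 1])
next
  case (insert a F)
  then obtain n \<delta> where n: "0 < \<delta>" "\<forall>z\<in>F. \<delta> \<le> hit i n z" by auto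
  obtain k where k: "0 < hit i k a"
    using hit_pos_eventually[OF i] insert.prems by (metis insert_subset statesE)
  have "min \<delta> (hit i k a) \<le> hit i (max n k) z" if "z \<in> insert a F" for z
  proof (cases "z = a")
    case True
    then show ?thesis
      using hit_mono[of a k "max n k" i] insert.prems by simp
  next
    case False
    then have "\<delta> \<le> hit i n z" "z \<in> E"
      using that n insert.prems by auto
    then show ?thesis
      using hit_mono[of z n "max n k" i] by simp
  qed
  then show ?case
    using n(1) k by (intro exI[of _ "max n k"] exI[of _ "min \<delta> (hit i k a)"]) auto
qed

section \<open>A Lyapunov function\<close>

text \<open>Counted in units, the total \<open>m + y\<close> grows by immigration at rate \<open>p\<close> and shrinks by deaths at rate
  \<open>y / \<beta>\<close>, which is no help while \<open>y\<close> is small and \<open>m = \<Gamma> x\<close> large. The extra weight \<open>1 / (2 * \<beta>)\<close>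
  on \<open>m\<close> turns every conversion, at rate \<open>x (y + \<alpha>)\<close>, into a loss; the reverse reaction then gains
  \<open>y / (2 * \<beta>)\<close>, half of what the deaths take away.\<close>

definition lyapunov :: "real \<times> nat \<Rightarrow> real" where
  "lyapunov = (\<lambda>(x, y). (1 + 1 / (2 * \<beta>)) * (\<Gamma> * x) + real y)"

lemma lyapunov_site: "lyapunov (site m y) = (1 + 1 / (2 * \<beta>)) * real m + real y"
  using \<Gamma> by (simp add: lyapunov_def site_def)

lemma lyapunov_nonneg: "w \<in> E \<Longrightarrow> 0 \<le> lyapunov w"
  using \<beta> by (auto elim!: statesE simp: lyapunov_site)

lemma L1_lyapunov:
  "L lyapunov (site m y) =
    (1 + 1 / (2 * \<beta>)) * p - (real m / \<Gamma> * (real y + \<alpha>) + real y) / (2 * \<beta>)"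
proof -
  have conversion: "real m * (lyapunov (site (m - 1) (y + 1)) - lyapunov (site m y)) =
      real m * (- 1 / (2 * \<beta>))"
    by (cases m) (use \<beta> in \<open>simp_all add: lyapunov_site field_simps\<close>)
  have reversion: "real y * (lyapunov (site (m + 1) (y - 1)) - lyapunov (site m y)) =
      real y * (1 / (2 * \<beta>))"
    by (cases y) (use \<beta> in \<open>simp_all add: lyapunov_site field_simps\<close>)
  have death: "real y * (lyapunov (site m (y - 1)) - lyapunov (site m y)) = - real y"
    by (cases y) (use \<beta> in \<open>simp_all add: lyapunov_site field_simps\<close>)
  have "L lyapunov (site m y) =
      (real y + \<alpha>) / \<Gamma> * (real m * (lyapunov (site (m - 1) (y + 1)) - lyapunov (site m y)))
    + real y * (lyapunov (site (m + 1) (y - 1)) - lyapunov (site m y))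
    + p * (lyapunov (site (m + 1) y) - lyapunov (site m y))
    + inverse \<beta> * (real y * (lyapunov (site m (y - 1)) - lyapunov (site m y)))"
    unfolding L1_site by (simp add: mult.assoc)
  also have "\<dots> = (real y + \<alpha>) / \<Gamma> * (real m * (- 1 / (2 * \<beta>))) + real y * (1 / (2 * \<beta>))
    + p * (1 + 1 / (2 * \<beta>)) + inverse \<beta> * (- real y)"
    unfolding conversion reversion death by (simp add: lyapunov_site algebra_simps add_divide_distrib)
  also have "\<dots> = (1 + 1 / (2 * \<beta>)) * p - (real m / \<Gamma> * (real y + \<alpha>) + real y) / (2 * \<beta>)"
    using \<beta> \<Gamma> by (simp add: field_simps)
  finally show ?thesis .
qed

text \<open>Spontaneous conversion at rate \<open>\<alpha> x\<close> keeps \<open>x\<close> bounded on this set even for \<open>y = 0\<close>.\<close>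

lemma finite_low_intensity:
  "finite {w \<in> E. fst w * (real (snd w) + \<alpha>) + real (snd w) \<le> r}"
proof -
  have "{w \<in> E. fst w * (real (snd w) + \<alpha>) + real (snd w) \<le> r} \<subseteq>
      (\<lambda>(m, y). site m y) ` ({..nat \<lceil>r * \<Gamma> / \<alpha>\<rceil>} \<times> {..nat \<lceil>r\<rceil>})"
  proof
    fix w assume w: "w \<in> {w \<in> E. fst w * (real (snd w) + \<alpha>) + real (snd w) \<le> r}"
    then obtain m y where my: "w = site m y" by (auto elim: statesE)
    have r: "real m / \<Gamma> * (real y + \<alpha>) + real y \<le> r"
      using w by (simp add: my site_def)
    have "0 \<le> real m / \<Gamma> * real y" "0 \<le> real m / \<Gamma> * \<alpha>"
      using \<Gamma> \<alpha> by simp_all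
    with r have y: "real y \<le> r" and m: "real m / \<Gamma> * \<alpha> \<le> r"
      by (simp_all add: distrib_left)
    have "real m \<le> r * \<Gamma> / \<alpha>"
      using m \<Gamma> \<alpha> by (simp add: field_simps)
    then have "m \<le> nat \<lceil>r * \<Gamma> / \<alpha>\<rceil>" "y \<le> nat \<lceil>r\<rceil>"
      using y by linarith+
    then show "w \<in> (\<lambda>(m, y). site m y) ` ({..nat \<lceil>r * \<Gamma> / \<alpha>\<rceil>} \<times> {..nat \<lceil>r\<rceil>})"
      using my by force
  qed
  then show ?thesis
    by (rule finite_subset) simp
qed

text \<open>Drift and exit rate are both of the order of \<open>x (y + \<alpha>) + y\<close>, so the drift is negative per jump and
  not merely per unit of time.\<close>

lemma L1_lyapunov_drift:
  obtains \<eta> F where "0 < \<eta>" "finite F" "F \<subseteq> E"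
    "\<And>w. w \<in> E \<Longrightarrow> w \<notin> F \<Longrightarrow> L lyapunov w \<le> - \<eta> * q w"
proof -
  (* eta is such that eta * q takes up half of the negative drift; r makes the other half
     outweigh the constant terms. *)
  define \<eta> where "\<eta> = 1 / (4 * (\<beta> + 1))"
  define B where "B = (1 + 1 / (2 * \<beta>)) * p"
  define r where "r = 4 * \<beta> * (B + \<eta> * p)"
  let ?s = "\<lambda>w. fst w * (real (snd w) + \<alpha>) + real (snd w)"
  have \<eta>: "0 < \<eta>" using \<beta> by (simp add: \<eta>_def)
  have "L lyapunov w \<le> - \<eta> * q w" if w: "w \<in> E" and high: "r < ?s w" for w
  proof -
    obtain m y where my: "w = site m y" using w by (rule statesE)
    have s_eq: "?s w = real m / \<Gamma> * (real y + \<alpha>) + real y"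
      by (simp add: my site_def)
    have "a + real y + p + inverse \<beta> * real y \<le> (1 + 1 / \<beta>) * (a + real y) + p" if "0 \<le> a" for a
      using that \<beta> by (simp add: algebra_simps inverse_eq_divide)
    then have "q w \<le> (1 + 1 / \<beta>) * ?s w + p"
      unfolding s_eq unfolding my exit_rate_site using \<Gamma> \<alpha> by simp
    then have "\<eta> * q w \<le> \<eta> * ((1 + 1 / \<beta>) * ?s w + p)"
      using \<eta> by simp
    also have "\<dots> = ?s w / (4 * \<beta>) + \<eta> * p"
    proof -
      have "\<eta> * (1 + 1 / \<beta>) = 1 / (4 * \<beta>)"
        using \<beta> by (simp add: \<eta>_def divide_simps)
      then show ?thesis
        by (metis (no_types, lifting) distrib_left mult.assoc mult.left_neutral times_divide_eq_left)
    qed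
    finally have "\<eta> * q w \<le> ?s w / (4 * \<beta>) + \<eta> * p" .
    moreover have "B + \<eta> * p \<le> ?s w / (4 * \<beta>)"
      using high \<beta> by (simp add: r_def field_simps)
    moreover have "L lyapunov w = B - ?s w / (2 * \<beta>)"
      unfolding s_eq unfolding my L1_lyapunov B_def ..
    moreover have "?s w / (2 * \<beta>) = ?s w / (4 * \<beta>) + ?s w / (4 * \<beta>)"
      using \<beta> by (simp add: field_simps)
    ultimately show ?thesis by linarith
  qed
  then show ?thesis
    using that[OF \<eta> finite_low_intensity[of r]] by force
qed

text \<open>Subtracting a large multiple of the discounted hitting probability of \<open>i\<close> makes the drift
  negative on the exceptional finite set too, except at \<open>i\<close>, and does not spoil it elsewhere. As
  hitting probabilities are at most 1, a constant restores nonnegativity.\<close>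

lemma exists_lyapunov_off_state:
  assumes i: "i \<in> E"
  obtains V where "\<And>w. w \<in> E \<Longrightarrow> 0 \<le> V w"
    "\<And>w. w \<in> E \<Longrightarrow> w \<noteq> i \<Longrightarrow> average V w + 1 \<le> V w"
proof -
  obtain \<eta> F where \<eta>: "0 < \<eta>" and F: "finite F" "F \<subseteq> E"
    and drift: "\<And>w. w \<in> E \<Longrightarrow> w \<notin> F \<Longrightarrow> L lyapunov w \<le> - \<eta> * q w"
    using L1_lyapunov_drift by blast
  obtain n \<delta> where \<delta>: "0 < \<delta>" and hit: "\<And>z. z \<in> F \<Longrightarrow> \<delta> \<le> hit i n z"
    using hit_bounded_below[OF i F] by blast
  define B where "B = (1 + 1 / (2 * \<beta>)) * p"
  (* B bounds the drift of the Lyapunov function; the summand 1 leaves a drift of - q on F. *)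
  define C where "C = (B / (\<eta> * p) + 1) / \<delta>"
  have B: "0 < B" and C: "0 < C"
    using \<beta> p \<eta> \<delta> by (simp_all add: B_def C_def add_pos_pos)
  define V where "V w = lyapunov w / \<eta> + C * (1 - hit i n w)" for w
  have linear: "L (\<lambda>z. e * g z + c * (1 - h z)) w = e * L g w - c * L h w" for e c g h w
    by (simp add: L1_def algebra_simps split: prod.split)
  have LV: "L V w = L lyapunov w / \<eta> - C * L (hit i n) w" for w
    using linear[of "1 / \<eta>" lyapunov C "hit i n" w] by (simp add: V_def[abs_def])
  have "L V w \<le> - q w" if w: "w \<in> E" and "w \<noteq> i" for w
  proof (cases "w \<in> F")
    case False
    have "0 \<le> L (hit i n) w"
      using L1_hit_ge[OF that, of n] hit_bounds[OF w, of i n] exit_rate_pos[OF w]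
      by (meson less_imp_le mult_nonneg_nonneg order_trans)
    moreover have "L lyapunov w / \<eta> \<le> - q w"
      using drift[OF w False] \<eta> by (simp add: field_simps)
    ultimately show ?thesis
      using C by (simp add: LV) (smt (verit) mult_nonneg_nonneg)
  next
    case True
    obtain m y where my: "w = site m y" using w by (rule statesE)
    have "0 \<le> (real m / \<Gamma> * (real y + \<alpha>) + real y) / (2 * \<beta>)"
      using \<Gamma> \<alpha> \<beta> by simp
    then have "L lyapunov w \<le> B"
      unfolding my L1_lyapunov B_def by simp
    then have "L lyapunov w / \<eta> \<le> B / \<eta>"
      using \<eta> by (simp add: divide_right_mono)
    also have "\<dots> \<le> B / (\<eta> * p) * q w"
      using exit_rate_ge[OF w] B \<eta> p by (simp add: field_simps)
    finally have "L lyapunov w / \<eta> \<le> B / (\<eta> * p) * q w" .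
    moreover have "(B / (\<eta> * p) + 1) * q w \<le> C * L (hit i n) w"
    proof -
      have "(B / (\<eta> * p) + 1) * q w = C * (q w * \<delta>)"
        using \<delta> by (simp add: C_def)
      also have "\<dots> \<le> C * (q w * hit i n w)"
        using C hit[OF True] exit_rate_pos[OF w] by simp
      also have "\<dots> \<le> C * L (hit i n) w"
        using C L1_hit_ge[OF that, of n] by simp
      finally show ?thesis .
    qed
    ultimately show ?thesis
      by (simp add: LV distrib_right)
  qed
  then have "L V w / q w \<le> - 1" if "w \<in> E" "w \<noteq> i" for w
    using that exit_rate_pos[OF that(1)] by (simp add: pos_divide_le_eq)
  then have "average V w + 1 \<le> V w" if "w \<in> E" "w \<noteq> i" for w
    using that unfolding average_def by fastforce
  moreover have "0 \<le> V w" if "w \<in> E" for w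
    using lyapunov_nonneg[OF that] hit_bounds[OF that, of i n] \<eta> C by (simp add: V_def)
  ultimately show ?thesis
    using that by blast
qed

end

theorem theorem3p9:
  fixes \<Gamma> \<beta> p \<alpha> :: real
    and P :: "real \<times> nat \<Rightarrow> 'w measure"
    and Y :: "nat \<Rightarrow> 'w \<Rightarrow> real \<times> nat"
    and S :: "nat \<Rightarrow> 'w \<Rightarrow> ennreal"
  assumes "\<Gamma> > 0" and "\<beta> > 0" and "p > 0" and "\<alpha> > 0"
    and "is_markov_chain (lattice_states \<Gamma>) (Q_matrix (L1 \<Gamma> \<beta> p \<alpha>)) P Y S"
    and "\<Gamma> \<ge> \<beta>"
  shows "positive_recurrent (lattice_states \<Gamma>) (Q_matrix (L1 \<Gamma> \<beta> p \<alpha>)) P Y S"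
proof -
  interpret reaction_chain \<Gamma> \<beta> p \<alpha>
    by unfold_locales fact+
  have "(\<integral>\<^sup>+ \<omega>. return_time Y S i \<omega> \<partial>P i) < \<infinity>" if i: "i \<in> E" for i
  proof -
    interpret jump_holding_chain E Q P Y S i
      by unfold_locales (use assms(5) i jump_matrix_nonneg jump_matrix_sum in auto)
    obtain V where V: "\<And>w. w \<in> E \<Longrightarrow> 0 \<le> V w"
      and drift: "\<And>w. w \<in> E \<Longrightarrow> w \<noteq> i \<Longrightarrow> average V w + 1 \<le> V w"
      using exists_lyapunov_off_state[OF i] by blast
    show ?thesis
    proof (rule expected_return_time_finite[OF exit_rate_ge \<open>p > 0\<close>])
      fix w assume w: "w \<in> E" "w \<noteq> i"
      have "ennreal (average V w) + 1 = ennreal (average V w + 1)"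
        using average_nonneg[OF V w(1)] by simp
      also have "\<dots> \<le> ennreal (V w)"
        by (rule ennreal_leI[OF drift[OF w]])
      finally show "(\<integral>\<^sup>+ z. ennreal (jump_matrix Q w z) * ennreal (V z) \<partial>count_space E) + 1 \<le> ennreal (V w)"
        by (simp only: nn_integral_jump_matrix[OF w(1) V])
    next
      show "(\<integral>\<^sup>+ z. ennreal (jump_matrix Q i z) * ennreal (V z) \<partial>count_space E) < \<infinity>"
        by (subst nn_integral_jump_matrix[OF i V]) simp_all
    qed
  qed
  then show ?thesis
    by (simp add: positive_recurrent_def positive_recurrent_state_def)
qed

end
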